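(* Consider the reverse update scheme for a flow from $s$ to $d$ in a connected graph $G=(V,E)$, enhanced with distance labels as described in the context. With the controller as prover $\mathcal{P}$ and the distributed verifier $\mathcal{V}$ of the context, the enhanced scheme is locally verifiable for both blackhole freedom and loop freedom. That is: (1) For every new simple path $P'=(p_0=s,p_1,\dots,p_k=d)$ in $G$, with $k\ge 1$, and every asynchronous execution of the enhanced scheme with the labels that $\mathcal{P}$ assigns for $P'$, at every point in time the configuration for $F'$ is blackhole-free and loop-free, and every node outputs YES. (2) In every configuration for $F'$, with arbitrary labels, that is not blackhole-free or not loop-free, at least one node outputs NO. Equivalently, if all nodes output YES, then the configuration is both blackhole-free and loop-free.
   Context: The network is a finite connected graph $G=(V,E)$ whose nodes have unique identifiers. Fix distinct nodes $s$ (source) and $d$ (destination). A flow from $s$ to $d$ currently uses rules for a tag $F$, and is to be moved to a new path whose rules match a new tag $F'$. Rules for tag $F$ are left untouched during the update, so only rules for $F'$ matter. Configuration for $F'$. A configuration specifies a set $A\subseteq V$ of updated nodes (nodes that have applied a label for $F'$) and for each $v\in A$ an applied label $(\mathrm{succ}(v),\mathrm{dist}(v))$, where $\mathrm{dist}(v)\in\mathbb{Z}_{\ge 0}$ and $\mathrm{succ}(v)$ is either a neighbor of $v$ in $G$ or $\bot$ (no successor). A node $v\in A$ with $\mathrm{succ}(v)=w\ne\bot$ forwards packets tagged $F'$ to $w$; nodes outside $A$ have no rule for $F'$. The source tags packets with $F'$ only if $s\in A$. Properties. The configuration is blackhole-free if every $v\in A\setminus\{d\}$ has $\mathrm{succ}(v)\neq\bot$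 and $\mathrm{succ}(v)\in A$. It is loop-free if the directed graph with edges $(v,\mathrm{succ}(v))$, for $v\in A$ with $\mathrm{succ}(v)\ne\bot$, contains no directed cycle. Prover $\mathcal{P}$. For a simple path $P'=(p_0=s,\dots,p_k=d)$ in $G$, the controller sends to $p_i$, for $i<k$, the label $(p_{i+1},k-i)$, i.e. the successor on the path and the hop distance to $d$ along the path; it sends $(\bot,0)$ to $d$. Nodes not on $P'$ receive no label. Enhanced reverse update scheme. Initially $A=\emptyset$. Labels and messages between neighbors arrive after arbitrary finite delays. A node that has received a label does not necessarily apply it immediately: $d$ may apply a received label $(\bot,0)$ at any time after receipt; a node $v\ne d$ that has received $(w,\delta)$ may apply it only when $w\in A$ already and $\mathrm{dist}(w)=\delta-1$. Nodes apply labels one at a time, in any order allowed by these rules, and an applied label is never changed afterwards. Verifier $\mathcal{V}$. Each node sees its own applied label (if any) and those of its neighbors. A node $v\notin A$ outputs YES. The node $d$, if $d\in A$, outputs YES iff its label is $(\bot,0)$. A node $v\in A\setminus\{d\}$ outputs YES iff $\mathrm{succ}(v)\ne\bot$, $\mathrm{succ}(v)\in A$, and $\mathrm{dist}(\mathrm{succ}(v))=\mathrm{dist}(v)-1$. Otherwise the node outputs NO. *)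

theory Defs
  imports Graph_Theory.Graph_Theory
begin

text \<open>
  An undirected network is a symmetric digraph whose arcs are ordered pairs of nodes; the nodes
  themselves serve as identifiers.
\<close>

definition neighbors :: "'v pair_pre_digraph \<Rightarrow> 'v \<Rightarrow> 'v set" where
  "neighbors G v = {w. (v, w) \<in> parcs G}"

text \<open>\<^term>\<open>None\<close> as successor stands for the missing successor (bottom).\<close>

datatype 'v label = Label (succ_of: "'v option") (dist_of: nat)

text \<open>
  Only the rules for the new tag are represented. The set of updated nodes of a configuration
  \<open>C\<close> is \<open>dom C\<close>.
\<close>

type_synonym 'v config = "'v \<Rightarrow> 'v label option"

definition configuration :: "'v pair_pre_digraph \<Rightarrow> 'v config \<Rightarrow> bool" where
  "configuration G C \<longleftrightarrow>
     dom C \<subseteq> pverts G \<and>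
     (\<forall>v l w. C v = Some l \<longrightarrow> succ_of l = Some w \<longrightarrow> w \<in> neighbors G v)"

definition blackhole_free :: "'v \<Rightarrow> 'v config \<Rightarrow> bool" where
  "blackhole_free d C \<longleftrightarrow>
     (\<forall>v l. v \<noteq> d \<longrightarrow> C v = Some l \<longrightarrow> (\<exists>w. succ_of l = Some w \<and> w \<in> dom C))"

definition forwarding_graph :: "'v pair_pre_digraph \<Rightarrow> 'v config \<Rightarrow> 'v pair_pre_digraph" where
  "forwarding_graph G C =
     \<lparr> pverts = pverts G, parcs = {(v, w). \<exists>l. C v = Some l \<and> succ_of l = Some w} \<rparr>"

definition loop_free :: "'v pair_pre_digraph \<Rightarrow> 'v config \<Rightarrow> bool" where
  "loop_free G C \<longleftrightarrow> \<not> (\<exists>p. pre_digraph.cycle (with_proj (forwarding_graph G C)) p)"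

definition new_path :: "'v pair_pre_digraph \<Rightarrow> 'v \<Rightarrow> 'v \<Rightarrow> 'v list \<Rightarrow> bool" where
  "new_path G s d P \<longleftrightarrow> vpath P (with_proj G) \<and> hd P = s \<and> last P = d \<and> vwalk_length P \<ge> 1"

definition prover :: "'v list \<Rightarrow> 'v config" where
  "prover P =
     (let k = vwalk_length P
      in map_of (map (\<lambda>i. (P ! i, Label (if i < k then Some (P ! (i + 1)) else None) (k - i)))
                     [0..<length P]))"

record 'v state =
  received :: "'v config"
  applied :: "'v config"

text \<open>
  The rule \<open>apply_other\<close> reads the label currently applied by \<open>w\<close>. Applied labels never
  change, so a delayed message from \<open>w\<close> to \<open>v\<close> can only postpone the step, and every
  postponement is among the executions considered.
\<close>

inductive step :: "'v \<Rightarrow> 'v config \<Rightarrow> 'v state \<Rightarrow> 'v state \<Rightarrow> bool"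
  for d :: 'v and L :: "'v config" where
  receive:
    "L v = Some l \<Longrightarrow> received S v = None \<Longrightarrow>
     step d L S (S\<lparr>received := (received S)(v \<mapsto> l)\<rparr>)"
| apply_dest:
    "received S d = Some (Label None 0) \<Longrightarrow> applied S d = None \<Longrightarrow>
     step d L S (S\<lparr>applied := (applied S)(d \<mapsto> Label None 0)\<rparr>)"
| apply_other:
    "v \<noteq> d \<Longrightarrow> received S v = Some (Label (Some w) \<delta>) \<Longrightarrow> applied S v = None \<Longrightarrow>
     applied S w = Some l \<Longrightarrow> int (dist_of l) = int \<delta> - 1 \<Longrightarrow>
     step d L S (S\<lparr>applied := (applied S)(v \<mapsto> Label (Some w) \<delta>)\<rparr>)"

text \<open>
  Stuttering accounts for instants at which nothing happens, in particular after the last step.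
  The third condition says that every label sent arrives after a finite delay.
\<close>

definition execution :: "'v \<Rightarrow> 'v config \<Rightarrow> (nat \<Rightarrow> 'v state) \<Rightarrow> bool" where
  "execution d L \<sigma> \<longleftrightarrow>
     \<sigma> 0 = \<lparr>received = Map.empty, applied = Map.empty\<rparr> \<and>
     (\<forall>t. \<sigma> (Suc t) = \<sigma> t \<or> step d L (\<sigma> t) (\<sigma> (Suc t))) \<and>
     (\<forall>v \<in> dom L. \<exists>t. v \<in> dom (received (\<sigma> t)))"

datatype answer = YES | NO

definition local_view :: "'v pair_pre_digraph \<Rightarrow> 'v config \<Rightarrow> 'v \<Rightarrow> 'v config" where
  "local_view G C v = C |` insert v (neighbors G v)"

text \<open>
  \<open>verifier d v V\<close> is the decision of node \<open>v\<close> from its local view \<open>V\<close> alone. Distances are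
  compared as integers: with truncated subtraction, distance 0 at both \<open>v\<close> and its successor
  would be accepted.
\<close>

definition verifier :: "'v \<Rightarrow> 'v \<Rightarrow> 'v config \<Rightarrow> answer" where
  "verifier d v V =
     (case V v of
        None \<Rightarrow> YES
      | Some l \<Rightarrow>
          if v = d then (if l = Label None 0 then YES else NO)
          else (case succ_of l of
                  None \<Rightarrow> NO
                | Some w \<Rightarrow>
                    (case V w of
                       None \<Rightarrow> NO
                     | Some l' \<Rightarrow> if int (dist_of l') = int (dist_of l) - 1 then YES else NO)))"

definition node_output :: "'v pair_pre_digraph \<Rightarrow> 'v \<Rightarrow> 'v config \<Rightarrow> 'v \<Rightarrow> answer" where
  "node_output G d C v = verifier d v (local_view G C v)"

end

theory Submission
  imports Defs
begin

text \<open>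
  The verifier accepts everywhere exactly when the distance drops by one along every forwarding
  arc and the arcs lead from updated nodes to updated nodes, ending only at the destination. Such
  a configuration has no blackhole, and the distance is a strictly decreasing potential that rules
  out cycles. The update scheme preserves this condition step by step, because a node applies its
  label only after its successor has applied one with distance smaller by one.
\<close>

text \<open>It speaks of the whole configuration, without graph or local views, so it can serve as
  an invariant of executions. \<open>Suc\<close> forces a positive distance at every updated node
  other than \<open>d\<close>.\<close>

definition distance_consistent :: "'v \<Rightarrow> 'v config \<Rightarrow> bool" where
  "distance_consistent d C \<longleftrightarrow>
     (\<forall>v l. C v = Some l \<longrightarrow>
        (if v = d then l = Label None 0
         else \<exists>w l'. succ_of l = Some w \<and> C w = Some l' \<and> dist_of l = Suc (dist_of l')))"

text \<open>The drops, each at least one, add up along the walk; for \<open>u = v\<close> only the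
  empty walk remains.\<close>

lemma pcas_potential_decreasing:
  fixes f :: "'v \<Rightarrow> nat"
  assumes "pcas u p v" and "\<And>e. e \<in> set p \<Longrightarrow> f (snd e) < f (fst e)"
  shows "f v + length p \<le> f u"
  using assms
proof (induction p arbitrary: u)
  case (Cons e p)
  then have "f v + length p \<le> f (snd e)" and "f (snd e) < f u"
    by auto
  then show ?case by simp
qed simp

lemma distance_consistent_blackhole_free:
  assumes "distance_consistent d C"
  shows "blackhole_free d C"
  using assms unfolding distance_consistent_def blackhole_free_def by (metis domI)

lemma distance_consistent_loop_free:
  assumes "distance_consistent d C"
  shows "loop_free G C"
  unfolding loop_free_def
proof
  let ?H = "with_proj (forwarding_graph G C)"
  assume "\<exists>p. pre_digraph.cycle ?H p"
  then obtain u p where arcs: "set p \<subseteq> parcs (forwarding_graph G C)" and "pcas u p u" and "p \<noteq> []"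
    by (auto simp: pre_digraph.cycle_def pre_digraph.awalk_def cas_with_proj_eq)
  \<comment> \<open>\<open>the\<close> is harmless: both ends of an arc carry labels, the tail by
    definition of the forwarding graph and the head by consistency.\<close>
  let ?f = "\<lambda>v. dist_of (the (C v))"
  have "?f (snd e) < ?f (fst e)" if e: "e \<in> set p" for e
  proof -
    from e arcs obtain l where "C (fst e) = Some l" and "succ_of l = Some (snd e)"
      by (force simp: forwarding_graph_def)
    \<comment> \<open>The tail is not \<open>d\<close>, whose label has no successor.\<close>
    with assms show ?thesis
      unfolding distance_consistent_def by (fastforce split: if_splits)
  qed
  with \<open>pcas u p u\<close> have "?f u + length p \<le> ?f u"
    by (rule pcas_potential_decreasing)
  with \<open>p \<noteq> []\<close> show False by simp
qed

text \<open>In a configuration the successor is a neighbor, so the local view shows its true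
  label.\<close>

lemma node_output_YES_iff:
  assumes "configuration G C"
  shows "node_output G d C v = YES \<longleftrightarrow>
    (\<forall>l. C v = Some l \<longrightarrow>
        (if v = d then l = Label None 0
         else \<exists>w l'. succ_of l = Some w \<and> C w = Some l' \<and> dist_of l = Suc (dist_of l')))"
proof (cases "C v")
  case None
  then show ?thesis by (simp add: node_output_def verifier_def local_view_def)
next
  case (Some l)
  have view: "local_view G C v w = C w" if "succ_of l = Some w" for w
    using assms Some that by (auto simp: configuration_def local_view_def)
  have "local_view G C v v = Some l"
    using Some by (simp add: local_view_def)
  with Some view show ?thesis
    by (auto simp: node_output_def verifier_def split: option.splits)
qed

lemma all_YES_iff_distance_consistent:
  assumes "configuration G C"
  shows "(\<forall>v \<in> pverts G. node_output G d C v = YES) \<longleftrightarrow> distance_consistent d C"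
proof -
  \<comment> \<open>Consistency ranges over the whole type, the outputs only over the nodes of
    \<open>G\<close>; every labelled node is among the latter.\<close>
  have "v \<in> pverts G" if "C v = Some l" for v l
    using assms that by (auto simp: configuration_def)
  then show ?thesis
    unfolding distance_consistent_def node_output_YES_iff[OF assms] by blast
qed

text \<open>Applied labels are always among those sent, so only the prover's full assignment has to
  be checked for adjacency.\<close>

lemma configuration_map_le:
  assumes "configuration G L" and "C \<subseteq>\<^sub>m L"
  shows "configuration G C"
proof -
  have "L v = Some l" if "C v = Some l" for v l
    using assms(2) that by (metis domI map_le_def)
  then show ?thesis
    using assms(1) unfolding configuration_def by (metis domD domI subset_iff)
qed

text \<open>A step labels only a node without a label, so the labels on which earlier nodes rely
  stay as they are; the guard gives the condition at the new node.\<close>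

lemma step_preserves:
  assumes "step d L S S'"
    and "received S \<subseteq>\<^sub>m L" and "applied S \<subseteq>\<^sub>m L" and "distance_consistent d (applied S)"
  shows "received S' \<subseteq>\<^sub>m L \<and> applied S' \<subseteq>\<^sub>m L \<and> distance_consistent d (applied S')"
  using assms
proof (cases rule: step.cases)
  case (receive v l)
  with assms show ?thesis by (auto simp: map_le_def)
next
  case apply_dest
  with assms(2) have "L d = Some (Label None 0)"
    by (metis domI map_le_def)
  with apply_dest assms show ?thesis
    by (fastforce simp: map_le_def distance_consistent_def)
next
  case (apply_other v w \<delta> l)
  \<comment> \<open>Since \<open>w\<close> is updated and \<open>v\<close> is not, they differ, and
    \<open>w\<close> keeps its label.\<close>
  with assms(2) have "L v = Some (Label (Some w) \<delta>)"
    by (metis domI map_le_def)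
  with apply_other assms show ?thesis
    by (fastforce simp: map_le_def distance_consistent_def)
qed

text \<open>The application rules alone enforce consistency, whatever labels \<open>L\<close> are
  sent.\<close>

lemma execution_invariant:
  assumes "execution d L \<sigma>"
  shows "received (\<sigma> t) \<subseteq>\<^sub>m L \<and> applied (\<sigma> t) \<subseteq>\<^sub>m L \<and> distance_consistent d (applied (\<sigma> t))"
proof (induction t)
  case 0
  from assms show ?case by (simp add: execution_def distance_consistent_def)
next
  case (Suc t)
  from assms have "\<sigma> (Suc t) = \<sigma> t \<or> step d L (\<sigma> t) (\<sigma> (Suc t))"
    by (simp add: execution_def)
  with Suc step_preserves show ?case by metis
qed

lemma nth_Suc_in_vwalk_arcs:
  "Suc i < length P \<Longrightarrow> (P ! i, P ! Suc i) \<in> set (vwalk_arcs P)"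
proof (induction P arbitrary: i rule: vwalk_arcs.induct)
  case (3 x y xs)
  then show ?case by (cases i) auto
qed auto

lemma configuration_prover:
  assumes "vwalk P (with_proj G)"
  shows "configuration G (prover P)"
proof -
  have verts: "set P \<subseteq> pverts G" and arcs: "set (vwalk_arcs P) \<subseteq> parcs G"
    using assms by (auto simp: vwalk_def)
  \<comment> \<open>\<open>map_of\<close> returns only listed entries, so each label stems from a
    position \<open>i\<close>; as \<open>k\<close> is \<open>length P - 1\<close>,
    \<open>i < k\<close> reads \<open>Suc i < length P\<close>.\<close>
  have label: "\<exists>i<length P. v = P ! i \<and>
      succ_of l = (if Suc i < length P then Some (P ! Suc i) else None)"
    if "prover P v = Some l" for v l
    using map_of_SomeD[OF that[unfolded prover_def Let_def]] by auto
  show ?thesis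
    unfolding configuration_def
  proof (intro conjI allI impI)
    show "dom (prover P) \<subseteq> pverts G"
      using label verts by (fastforce dest: nth_mem)
  next
    fix v l w
    assume "prover P v = Some l" and "succ_of l = Some w"
    with label obtain i where "Suc i < length P" and "v = P ! i" and "w = P ! Suc i"
      by (metis option.distinct(1) option.inject)
    with arcs nth_Suc_in_vwalk_arcs show "w \<in> neighbors G v"
      by (fastforce simp: neighbors_def)
  qed
qed

theorem theorem1:
  fixes G :: "'v pair_pre_digraph" and s d :: 'v
  assumes "pair_graph G" and "connected (with_proj G)"
    and "s \<in> pverts G" and "d \<in> pverts G" and "s \<noteq> d"
  shows "(\<forall>P \<sigma> t. new_path G s d P \<longrightarrow> execution d (prover P) \<sigma> \<longrightarrow>
            blackhole_free d (applied (\<sigma> t)) \<and> loop_free G (applied (\<sigma> t)) \<and>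
            (\<forall>v \<in> pverts G. node_output G d (applied (\<sigma> t)) v = YES)) \<and>
         (\<forall>C. configuration G C \<longrightarrow> \<not> (blackhole_free d C \<and> loop_free G C) \<longrightarrow>
            (\<exists>v \<in> pverts G. node_output G d C v = NO))"
proof (intro conjI allI impI)
  fix P \<sigma> t
  assume "new_path G s d P" and exec: "execution d (prover P) \<sigma>"
  then have "configuration G (prover P)"
    by (intro configuration_prover) (simp add: new_path_def vpath_def)
  then have conf: "configuration G (applied (\<sigma> t))"
    using execution_invariant[OF exec] by (blast intro: configuration_map_le)
  have cons: "distance_consistent d (applied (\<sigma> t))"
    using execution_invariant[OF exec] by blast
  show "blackhole_free d (applied (\<sigma> t))"
    using cons by (rule distance_consistent_blackhole_free)
  show "loop_free G (applied (\<sigma> t))"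
    using cons by (rule distance_consistent_loop_free)
  show "\<forall>v \<in> pverts G. node_output G d (applied (\<sigma> t)) v = YES"
    using cons all_YES_iff_distance_consistent[OF conf] by blast
next
  fix C
  assume conf: "configuration G C" and "\<not> (blackhole_free d C \<and> loop_free G C)"
  \<comment> \<open>Completeness of the alarm is the contrapositive: consistency would give both
    properties.\<close>
  then have "\<not> distance_consistent d C"
    using distance_consistent_blackhole_free distance_consistent_loop_free by metis
  then show "\<exists>v \<in> pverts G. node_output G d C v = NO"
    using all_YES_iff_distance_consistent[OF conf] answer.exhaust by metis
qed

end
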